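(* Let $G,H$ be infinite groups generated by the finite symmetric sets $S_G\subseteq G$ and $S_H\subseteq H$, respectively. Let $(G\wr H)_0=\{(f,x)\in G\wr H:\ x=e_H\}$ be the zero section of $G\wr H$. Then for all $p\in[1,2]$, $$\beta_p^*\left((G\wr H)_0,\,d_{G\wr H}\right)\ \ge\ \frac{2}{p+1}.$$
   Context: The (restricted) wreath product $G\wr H$ is the group of all pairs $(f,x)$ where $x\in H$ and $f:H\to G$ has finite support (i.e. $f(z)=e_G$ for all but finitely many $z$), with product $(f,x)(g,y)=\left(z\mapsto f(z)g(x^{-1}z),\,xy\right)$. $d_{G\wr H}$ is the left-invariant word metric associated with the generators $(\mathbf{e_G},t)$, $t\in S_H$, and $(\delta_s,e_H)$, $s\in S_G$, where $\mathbf{e_G}$ is the constant function $e_G$ and $\delta_s:H\to G$ takes the value $s$ at $e_H$ and $e_G$ elsewhere. The subgroup $\Gamma=(G\wr H)_0$ is equipped with the restriction $\rho$ of $d_{G\wr H}$. For a group $\Gamma$ with a left-invariant metric $\rho$ all of whose balls are finite: a probability measure $\mu$ on $\Gamma$ is symmetric if $\mu(\{g\})=\mu(\{g^{-1}\})$ for all $g$. For such $\mu$ let $g_1,g_2,\dots$ be i.i.d. elements of $\Gamma$ with law $\mu$, and set $W_0^\mu=e_\Gamma$, $W_t^\mu=g_1g_2\cdots g_t$. For a sequence $\{\mu_t\}_{t=1}^\infty$ of symmetric probability measures on $\Gamma$ put $$\beta_p^*\left(\{\mu_t\}_{t=1}^\infty,\rho\right)=\limsup_{t\to\infty}\frac{\log\left(\mathbb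 E_{\mu_t}\left[\rho(W_t^{\mu_t},e_\Gamma)\right]\right)}{\log\left(t\,\mathbb E_{\mu_t}\left[\rho(W_1^{\mu_t},e_\Gamma)^p\right]\right)}.$$ $\beta_p^*(\Gamma,\rho)$ is the supremum of $\beta_p^*(\{\mu_t\}_{t=1}^\infty,\rho)$ over all sequences of symmetric probability measures on $\Gamma$ with $\int_\Gamma\rho(x,e_\Gamma)^p\,d\mu_t(x)<\infty$ for all $t\in\mathbb N$ and $\lim_{t\to\infty}t\,\mu_t(\Gamma\setminus\{e_\Gamma\})=\infty$. *)

theory Defs
  imports
    "HOL-Algebra.Generated_Groups"
    "HOL-Probability.Probability_Mass_Function"
begin

section \<open>Word metrics\<close>

definition word_prod :: "('a, 'm) monoid_scheme \<Rightarrow> 'a list \<Rightarrow> 'a" where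
  "word_prod K gs = foldr (\<lambda>g h. g \<otimes>\<^bsub>K\<^esub> h) gs \<one>\<^bsub>K\<^esub>"

text \<open>Words use letters of \<open>S\<close> only, no inverses: the generating sets are symmetric.
  Where no word over \<open>S\<close> represents \<open>g\<close> the value is unspecified.\<close>

definition word_length :: "('a, 'm) monoid_scheme \<Rightarrow> 'a set \<Rightarrow> 'a \<Rightarrow> nat" where
  "word_length K S g = (LEAST n. \<exists>gs. length gs = n \<and> set gs \<subseteq> S \<and> word_prod K gs = g)"

definition word_dist :: "('a, 'm) monoid_scheme \<Rightarrow> 'a set \<Rightarrow> 'a \<Rightarrow> 'a \<Rightarrow> real" where
  "word_dist K S g h = real (word_length K S (inv\<^bsub>K\<^esub> g \<otimes>\<^bsub>K\<^esub> h))"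

definition symmetric_generating_set :: "('a, 'm) monoid_scheme \<Rightarrow> 'a set \<Rightarrow> bool" where
  "symmetric_generating_set K S \<longleftrightarrow>
     S \<subseteq> carrier K \<and> (\<forall>s\<in>S. inv\<^bsub>K\<^esub> s \<in> S) \<and> generate K S = carrier K"

section \<open>Restricted wreath products\<close>

text \<open>A function \<open>carrier H \<rightarrow> carrier G\<close> is represented by its extension with value
  \<open>undefined\<close> outside \<open>carrier H\<close>, so that equality is equality of functions on the carrier.\<close>

definition wreath ::
  "('g, 'm) monoid_scheme \<Rightarrow> ('h, 'n) monoid_scheme \<Rightarrow> (('h \<Rightarrow> 'g) \<times> 'h) monoid" where
  "wreath G H =
     \<lparr>carrier = {f \<in> carrier H \<rightarrow>\<^sub>E carrier G. finite {z \<in> carrier H. f z \<noteq> \<one>\<^bsub>G\<^esub>}} \<times> carrier H,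
      monoid.mult = (\<lambda>(f, x) (g, y).
        ((\<lambda>z\<in>carrier H. f z \<otimes>\<^bsub>G\<^esub> g (inv\<^bsub>H\<^esub> x \<otimes>\<^bsub>H\<^esub> z)), x \<otimes>\<^bsub>H\<^esub> y)),
      one = ((\<lambda>z\<in>carrier H. \<one>\<^bsub>G\<^esub>), \<one>\<^bsub>H\<^esub>)\<rparr>"

definition wreath_delta ::
  "('g, 'm) monoid_scheme \<Rightarrow> ('h, 'n) monoid_scheme \<Rightarrow> 'g \<Rightarrow> 'h \<Rightarrow> 'g" where
  "wreath_delta G H s = (\<lambda>z\<in>carrier H. if z = \<one>\<^bsub>H\<^esub> then s else \<one>\<^bsub>G\<^esub>)"

definition wreath_gens ::
  "('g, 'm) monoid_scheme \<Rightarrow> ('h, 'n) monoid_scheme \<Rightarrow> 'g set \<Rightarrow> 'h set \<Rightarrow> (('h \<Rightarrow> 'g) \<times> 'h) set" where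
  "wreath_gens G H SG SH =
     (\<lambda>t. ((\<lambda>z\<in>carrier H. \<one>\<^bsub>G\<^esub>), t)) ` SH \<union> (\<lambda>s. (wreath_delta G H s, \<one>\<^bsub>H\<^esub>)) ` SG"

definition wreath_dist ::
  "('g, 'm) monoid_scheme \<Rightarrow> ('h, 'n) monoid_scheme \<Rightarrow> 'g set \<Rightarrow> 'h set \<Rightarrow>
     ('h \<Rightarrow> 'g) \<times> 'h \<Rightarrow> ('h \<Rightarrow> 'g) \<times> 'h \<Rightarrow> real" where
  "wreath_dist G H SG SH = word_dist (wreath G H) (wreath_gens G H SG SH)"

definition zero_section ::
  "('g, 'm) monoid_scheme \<Rightarrow> ('h, 'n) monoid_scheme \<Rightarrow> (('h \<Rightarrow> 'g) \<times> 'h) monoid" where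
  "zero_section G H =
     (wreath G H)\<lparr>carrier := {(f, x) \<in> carrier (wreath G H). x = \<one>\<^bsub>H\<^esub>}\<rparr>"

section \<open>Random walks and the exponent \<open>\<beta>\<^sub>p\<^sup>*\<close>\<close>

text \<open>A group carrying a metric with finite balls is countable, so its probability measures
  are exactly the \<open>pmf\<close>s supported on the carrier.\<close>

definition symmetric_pmf_on :: "('a, 'm) monoid_scheme \<Rightarrow> 'a pmf \<Rightarrow> bool" where
  "symmetric_pmf_on K \<mu> \<longleftrightarrow>
     set_pmf \<mu> \<subseteq> carrier K \<and> (\<forall>g\<in>carrier K. pmf \<mu> g = pmf \<mu> (inv\<^bsub>K\<^esub> g))"

text \<open>The law of \<open>W\<^sub>t = g\<^sub>1 g\<^sub>2 \<cdots> g\<^sub>t\<close> for i.i.d. increments \<open>g\<^sub>i\<close> of law \<open>\<mu>\<close>.\<close>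

definition walk_pmf :: "('a, 'm) monoid_scheme \<Rightarrow> 'a pmf \<Rightarrow> nat \<Rightarrow> 'a pmf" where
  "walk_pmf K \<mu> t = map_pmf (word_prod K) (replicate_pmf t \<mu>)"

text \<open>The \<open>p\<close>-th moment of the distance to the identity; the value \<open>\<infinity>\<close> is allowed.\<close>

definition moment ::
  "real \<Rightarrow> ('a, 'm) monoid_scheme \<Rightarrow> ('a \<Rightarrow> 'a \<Rightarrow> real) \<Rightarrow> 'a pmf \<Rightarrow> ennreal" where
  "moment p K \<rho> \<mu> = (\<integral>\<^sup>+ g. ennreal (\<rho> g \<one>\<^bsub>K\<^esub> powr p) \<partial>measure_pmf \<mu>)"

text \<open>The logarithm with \<open>log 0 = - \<infinity>\<close>; in HOL, \<open>ln 0 = 0\<close> on the reals.\<close>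

definition elog :: "ennreal \<Rightarrow> ereal" where
  "elog x = (if x = 0 then - \<infinity> else if x = \<infinity> then \<infinity> else ereal (ln (enn2real x)))"

text \<open>If \<open>\<rho>\<close> is an integer-valued metric and \<open>\<mu>\<close> is admissible in the sense below, the denominators
  are eventually positive reals and tend to \<open>\<infinity>\<close>, and the numerators are less than \<open>\<infinity>\<close>;
  so the conventions of \<open>ereal\<close> division for degenerate quotients play no role.\<close>

definition beta_star_seq ::
  "real \<Rightarrow> ('a, 'm) monoid_scheme \<Rightarrow> ('a \<Rightarrow> 'a \<Rightarrow> real) \<Rightarrow> (nat \<Rightarrow> 'a pmf) \<Rightarrow> ereal" where
  "beta_star_seq p K \<rho> \<mu> =
     limsup (\<lambda>t. elog (moment 1 K \<rho> (walk_pmf K (\<mu> t) t)) /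
                 elog (of_nat t * moment p K \<rho> (walk_pmf K (\<mu> t) 1)))"

text \<open>Sequences are indexed by \<open>t \<ge> 1\<close>; the value at \<open>0\<close> is unconstrained and irrelevant.\<close>

definition admissible ::
  "real \<Rightarrow> ('a, 'm) monoid_scheme \<Rightarrow> ('a \<Rightarrow> 'a \<Rightarrow> real) \<Rightarrow> (nat \<Rightarrow> 'a pmf) \<Rightarrow> bool" where
  "admissible p K \<rho> \<mu> \<longleftrightarrow>
     (\<forall>t\<ge>1. symmetric_pmf_on K (\<mu> t) \<and> moment p K \<rho> (\<mu> t) < \<infinity>) \<and>
     filterlim (\<lambda>t. real t * measure_pmf.prob (\<mu> t) (carrier K - {\<one>\<^bsub>K\<^esub>})) at_top sequentially"

definition beta_star ::
  "real \<Rightarrow> ('a, 'm) monoid_scheme \<Rightarrow> ('a \<Rightarrow> 'a \<Rightarrow> real) \<Rightarrow> ereal" where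
  "beta_star p K \<rho> = (SUP \<mu>\<in>{\<mu>. admissible p K \<rho> \<mu>}. beta_star_seq p K \<rho> \<mu>)"

end

theory Submission
  imports Defs
begin

text \<open>
  The bound comes from one explicit family of random walks, one for each time \<open>t\<close>. Both \<open>G\<close> and
  \<open>H\<close> are infinite and finitely generated, so both contain elements of every word length. Choose
  \<open>a \<in> G\<close> of length \<open>t\<close> and \<open>t\<close> sites in \<open>H\<close> of lengths \<open>0, \<dots>, t - 1\<close>. A step of the walk picks
  one of these sites uniformly and multiplies the lamp there by \<open>a\<close> or by its inverse, with equal
  probability.

  A step is cheap: walking to the site, writing \<open>a\<close> and walking back takes at most \<open>3 t\<close> letters,
  and it takes at least \<open>t\<close> because the lamp has to be written. Hence \<open>t\<close> times the \<open>p\<close>-th moment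
  of a step has order \<open>t\<^bsup>p+1\<^esup>\<close>.

  The walk is far from the identity at time \<open>t\<close>. After \<open>t\<close> steps among \<open>t\<close> sites a positive
  proportion of the sites have been visited exactly once, and each such site carries a lamp of length
  \<open>t\<close>; the word length is at least the sum of the lengths of all lamps (\<open>lamp_mass_le_length\<close>), so
  it has order \<open>t\<^sup>2\<close>. Instead of counting visits, the proof follows the expected sum \<open>m\<close> of the lamp
  lengths over the sites. Switching a lamp of length \<open>l'\<close> changes its length by at least
  \<open>t - 2 l'\<close>, and averaging over the uniform site shows that the expectation goes from \<open>m\<close> to at
  least \<open>(1 - 2 / t) m + t\<close> (\<open>expected_lamp_mass_step\<close>). This recursion gives at least
  \<open>t\<^sup>2 / 3\<close> after \<open>t\<close> steps (\<open>expected_lamp_mass_walk\<close>).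

  So the quotient of logarithms at time \<open>t\<close> is at least \<open>ln (t\<^sup>2 / 3) / ln (t (3 t)\<^bsup>p\<^esup>)\<close>, which tends
  to \<open>2 / (p + 1)\<close>.
\<close>

section \<open>Word lengths in groups\<close>

lemma word_prod_Nil [simp]: "word_prod K [] = \<one>\<^bsub>K\<^esub>"
  and word_prod_Cons [simp]: "word_prod K (g # gs) = g \<otimes>\<^bsub>K\<^esub> word_prod K gs"
  by (simp_all add: word_prod_def)

lemma (in group) word_prod_closed:
  "set gs \<subseteq> carrier G \<Longrightarrow> word_prod G gs \<in> carrier G"
  by (induction gs) auto

lemma (in group) word_prod_append:
  "set gs \<subseteq> carrier G \<Longrightarrow> set hs \<subseteq> carrier G \<Longrightarrow>
     word_prod G (gs @ hs) = word_prod G gs \<otimes> word_prod G hs"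
  by (induction gs) (auto simp: word_prod_closed m_assoc)

text \<open>The estimates are made at elements of \<open>generate K S\<close>: there words exist, so that the
  minimum in the definition of the word length is attained.\<close>

locale symmetric_letters = group K for K :: "('a, 'm) monoid_scheme" (structure) +
  fixes S :: "'a set"
  assumes S_carrier: "S \<subseteq> carrier K"
    and S_inv: "s \<in> S \<Longrightarrow> inv s \<in> S"
begin

abbreviation len :: "'a \<Rightarrow> nat" where "len \<equiv> word_length K S"

lemma generate_closed: "g \<in> generate K S \<Longrightarrow> g \<in> carrier K"
  using generate_in_carrier S_carrier by blast

lemma generate_inv: "g \<in> generate K S \<Longrightarrow> inv g \<in> generate K S"
  using generate_m_inv_closed S_carrier by blast

lemma word_exists: "g \<in> generate K S \<Longrightarrow> \<exists>gs. set gs \<subseteq> S \<and> word_prod K gs = g"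
proof (induction g rule: generate.induct)
  case one
  show ?case by (rule exI[of _ "[]"]) simp
next
  case (incl h)
  then show ?case using S_carrier by (intro exI[of _ "[h]"]) auto
next
  case (inv h)
  then show ?case using S_carrier S_inv by (intro exI[of _ "[inv h]"]) auto
next
  case (eng h1 h2)
  then obtain gs hs where "set gs \<subseteq> S" "word_prod K gs = h1" "set hs \<subseteq> S" "word_prod K hs = h2"
    by auto
  then show ?case
    using S_carrier by (intro exI[of _ "gs @ hs"]) (auto simp: word_prod_append)
qed

lemma word_in_generate: "set gs \<subseteq> S \<Longrightarrow> word_prod K gs \<in> generate K S"
  by (induction gs) (auto intro: generate.intros)

lemma geodesic_word:
  assumes "g \<in> generate K S"
  obtains gs where "set gs \<subseteq> S" "word_prod K gs = g" "length gs = len g"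
proof -
  have "\<exists>gs. length gs = len g \<and> set gs \<subseteq> S \<and> word_prod K gs = g"
    unfolding word_length_def by (rule LeastI_ex) (use word_exists[OF assms] in blast)
  then show thesis using that by blast
qed

lemma len_word_le: "set gs \<subseteq> S \<Longrightarrow> len (word_prod K gs) \<le> length gs"
  unfolding word_length_def by (rule Least_le) blast

lemma len_one: "len \<one> = 0"
  using len_word_le[of "[]"] by simp

lemma len_letter_le: "s \<in> S \<Longrightarrow> len s \<le> 1"
  using len_word_le[of "[s]"] S_carrier by auto

lemma len_mult_le:
  assumes "g \<in> generate K S" "h \<in> generate K S"
  shows "len (g \<otimes> h) \<le> len g + len h"
proof -
  obtain gs where gs: "set gs \<subseteq> S" "word_prod K gs = g" "length gs = len g"
    using geodesic_word[OF assms(1)] .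
  obtain hs where hs: "set hs \<subseteq> S" "word_prod K hs = h" "length hs = len h"
    using geodesic_word[OF assms(2)] .
  have "word_prod K (gs @ hs) = g \<otimes> h"
    using gs hs S_carrier by (subst word_prod_append) auto
  then show ?thesis using len_word_le[of "gs @ hs"] gs hs by auto
qed

lemma word_prod_inverse:
  "set gs \<subseteq> S \<Longrightarrow> word_prod K (rev (map (m_inv K) gs)) = inv (word_prod K gs)"
proof (induction gs)
  case Nil
  then show ?case by simp
next
  case (Cons s gs)
  have "word_prod K (rev (map (m_inv K) (s # gs))) =
      word_prod K (rev (map (m_inv K) gs)) \<otimes> word_prod K [inv s]"
    using Cons.prems S_carrier S_inv by (simp, subst word_prod_append) auto
  moreover have "s \<in> carrier K" "word_prod K gs \<in> carrier K"
    using Cons.prems S_carrier word_prod_closed[of gs] by auto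
  ultimately show ?case
    using Cons by (simp add: inv_mult_group)
qed

lemma len_inv_le:
  assumes "g \<in> generate K S" shows "len (inv g) \<le> len g"
proof -
  obtain gs where gs: "set gs \<subseteq> S" "word_prod K gs = g" "length gs = len g"
    using geodesic_word[OF assms] .
  show ?thesis
    using len_word_le[of "rev (map (m_inv K) gs)"] gs S_inv word_prod_inverse[of gs] by auto
qed

lemma len_inv: "g \<in> generate K S \<Longrightarrow> len (inv g) = len g"
  using len_inv_le[of g] len_inv_le[of "inv g"] generate_inv generate_closed
  by (metis inv_inv le_antisym)

lemma len_le_len_mult:
  assumes "g \<in> generate K S" "h \<in> generate K S"
  shows "len g \<le> len (g \<otimes> h) + len h"
proof -
  have "g = (g \<otimes> h) \<otimes> inv h"
    using assms generate_closed by (simp add: m_assoc)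
  then show ?thesis
    using len_mult_le[of "g \<otimes> h" "inv h"] len_inv[OF assms(2)] assms generate_inv
    by (metis generate.eng)
qed

text \<open>An infinite group has only finitely many elements below any given length, hence elements
  beyond it; a prefix of a geodesic word is geodesic, so no length is skipped on the way.\<close>

lemma element_of_length:
  assumes "finite S" "generate K S = carrier K" "infinite (carrier K)"
  obtains g where "g \<in> carrier K" "len g = n"
proof -
  have "\<exists>g\<in>carrier K. n < len g"
  proof (rule ccontr)
    assume short: "\<not> ?thesis"
    have "carrier K \<subseteq> word_prod K ` {gs. set gs \<subseteq> S \<and> length gs \<le> n}"
    proof
      fix g assume "g \<in> carrier K"
      then obtain gs where "set gs \<subseteq> S" "word_prod K gs = g" "length gs = len g" "len g \<le> n"
        using geodesic_word[of g] assms(2) short by (metis not_less)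
      then show "g \<in> word_prod K ` {gs. set gs \<subseteq> S \<and> length gs \<le> n}" by auto
    qed
    then show False
      using assms(1,3) finite_lists_length_le finite_surj by blast
  qed
  then obtain g where g: "g \<in> generate K S" "n < len g" using assms(2) by blast
  obtain gs where gs: "set gs \<subseteq> S" "word_prod K gs = g" "length gs = len g"
    using geodesic_word[OF g(1)] .
  \<comment> \<open>Were the prefix of length \<open>n\<close> shorter than \<open>n\<close>, it could be replaced in the geodesic word.\<close>
  let ?u = "take n gs" and ?v = "drop n gs"
  have u: "set ?u \<subseteq> S" and v: "set ?v \<subseteq> S"
    using gs(1) set_take_subset set_drop_subset by fast+
  have "g = word_prod K ?u \<otimes> word_prod K ?v"
    using word_prod_append[of ?u ?v] u v S_carrier gs(2) by (metis append_take_drop_id subset_trans)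
  then have "len g \<le> len (word_prod K ?u) + len (word_prod K ?v)"
    using len_mult_le u v word_in_generate by metis
  moreover have "len (word_prod K ?u) \<le> n" "len (word_prod K ?v) \<le> len g - n"
    using len_word_le[OF u] len_word_le[OF v] gs(3) g(2) by auto
  ultimately have "len (word_prod K ?u) = n" using g(2) by linarith
  moreover have "word_prod K ?u \<in> carrier K"
    using word_in_generate[OF u] assms(2) by simp
  ultimately show thesis using that by blast
qed

end

lemma symmetric_letters_hom_generate:
  assumes "symmetric_letters K S" "group L" "h \<in> hom K L" "h ` S \<subseteq> T" "g \<in> generate K S"
  shows "h g \<in> generate L T"
proof -
  interpret symmetric_letters K S by fact
  interpret h: group_hom K L h
    using assms by (intro group_hom.intro group_hom_axioms.intro) (auto intro: is_group)
  show ?thesis using assms(5)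
  proof (induction g rule: generate.induct)
    case (inv s)
    then show ?case using assms(4) S_inv by (auto intro: generate.incl)
  next
    case (eng a b)
    then show ?case using generate_closed by (auto intro: generate.eng)
  qed (use assms(4) in \<open>auto intro: generate.intros\<close>)
qed

lemma word_length_hom_le:
  assumes "symmetric_letters K S" "symmetric_letters L T" "h \<in> hom K L" "h ` S \<subseteq> T"
    "g \<in> generate K S"
  shows "word_length L T (h g) \<le> word_length K S g"
proof -
  interpret K: symmetric_letters K S by fact
  interpret L: symmetric_letters L T by fact
  interpret h: group_hom K L h
    using assms by (intro group_hom.intro group_hom_axioms.intro) (auto intro: K.is_group L.is_group)
  have word: "word_prod L (map h gs) = h (word_prod K gs)" if "set gs \<subseteq> S" for gs
    using that
  proof (induction gs)
    case (Cons a gs)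
    moreover have "a \<in> carrier K" "word_prod K gs \<in> carrier K"
      using Cons.prems K.S_carrier K.word_prod_closed[of gs] by auto
    ultimately show ?case by simp
  qed simp
  obtain gs where "set gs \<subseteq> S" "word_prod K gs = g" "length gs = K.len g"
    using K.geodesic_word[OF assms(5)] .
  then show ?thesis using L.len_word_le[of "map h gs"] word[of gs] assms(4) by auto
qed

section \<open>The wreath product and its word length\<close>

text \<open>In the lamplighter picture \<open>(f, x)\<close> records a lamp in state \<open>f z \<in> G\<close> at every site
  \<open>z \<in> H\<close> and a marker at the site \<open>x\<close>; the state \<open>\<one>\<close> means that a lamp is off. The generators of the
  wreath product are the elements \<open>shift x\<close> and \<open>lamp \<one> s\<close> below, for generators \<open>x\<close> of \<open>H\<close> and
  \<open>s\<close> of \<open>G\<close>.\<close>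

definition lamp ::
  "('g, 'm) monoid_scheme \<Rightarrow> ('h, 'n) monoid_scheme \<Rightarrow> 'h \<Rightarrow> 'g \<Rightarrow> ('h \<Rightarrow> 'g) \<times> 'h" where
  "lamp G H z a = ((\<lambda>w\<in>carrier H. if w = z then a else \<one>\<^bsub>G\<^esub>), \<one>\<^bsub>H\<^esub>)"

definition shift ::
  "('g, 'm) monoid_scheme \<Rightarrow> ('h, 'n) monoid_scheme \<Rightarrow> 'h \<Rightarrow> ('h \<Rightarrow> 'g) \<times> 'h" where
  "shift G H x = ((\<lambda>w\<in>carrier H. \<one>\<^bsub>G\<^esub>), x)"

locale wreath_product = G: group G + H: group H
  for G :: "('g, 'm) monoid_scheme" and H :: "('h, 'n) monoid_scheme"
begin

abbreviation W :: "(('h \<Rightarrow> 'g) \<times> 'h) monoid" where "W \<equiv> wreath G H"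

lemma wreath_carrier:
  "(f, x) \<in> carrier W \<longleftrightarrow>
     f \<in> carrier H \<rightarrow>\<^sub>E carrier G \<and> finite {z \<in> carrier H. f z \<noteq> \<one>\<^bsub>G\<^esub>} \<and> x \<in> carrier H"
  by (auto simp: wreath_def)

lemma wreath_mult:
  "(f, x) \<otimes>\<^bsub>W\<^esub> (g, y) =
     ((\<lambda>z\<in>carrier H. f z \<otimes>\<^bsub>G\<^esub> g (inv\<^bsub>H\<^esub> x \<otimes>\<^bsub>H\<^esub> z)), x \<otimes>\<^bsub>H\<^esub> y)"
  by (simp add: wreath_def)

lemma wreath_one: "\<one>\<^bsub>W\<^esub> = ((\<lambda>z\<in>carrier H. \<one>\<^bsub>G\<^esub>), \<one>\<^bsub>H\<^esub>)"
  by (simp add: wreath_def)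

lemma wreath_value:
  "(f, x) \<in> carrier W \<Longrightarrow> z \<in> carrier H \<Longrightarrow> f z \<in> carrier G"
  by (auto simp: wreath_carrier)

lemma wreath_mult_closed:
  assumes "(f, x) \<in> carrier W" "(g, y) \<in> carrier W"
  shows "(f, x) \<otimes>\<^bsub>W\<^esub> (g, y) \<in> carrier W"
proof -
  have x: "x \<in> carrier H" and y: "y \<in> carrier H"
    and fin: "finite {z \<in> carrier H. f z \<noteq> \<one>\<^bsub>G\<^esub>}" "finite {z \<in> carrier H. g z \<noteq> \<one>\<^bsub>G\<^esub>}"
    using assms by (auto simp: wreath_carrier)
  have "{z \<in> carrier H. f z \<otimes>\<^bsub>G\<^esub> g (inv\<^bsub>H\<^esub> x \<otimes>\<^bsub>H\<^esub> z) \<noteq> \<one>\<^bsub>G\<^esub>} \<subseteq>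
      {z \<in> carrier H. f z \<noteq> \<one>\<^bsub>G\<^esub>} \<union> (\<lambda>z. x \<otimes>\<^bsub>H\<^esub> z) ` {z \<in> carrier H. g z \<noteq> \<one>\<^bsub>G\<^esub>}"
  proof
    fix z assume z: "z \<in> {z \<in> carrier H. f z \<otimes>\<^bsub>G\<^esub> g (inv\<^bsub>H\<^esub> x \<otimes>\<^bsub>H\<^esub> z) \<noteq> \<one>\<^bsub>G\<^esub>}"
    then have "x \<otimes>\<^bsub>H\<^esub> (inv\<^bsub>H\<^esub> x \<otimes>\<^bsub>H\<^esub> z) = z" "inv\<^bsub>H\<^esub> x \<otimes>\<^bsub>H\<^esub> z \<in> carrier H"
      using x by (auto simp: H.m_assoc[symmetric])
    with z show "z \<in> {z \<in> carrier H. f z \<noteq> \<one>\<^bsub>G\<^esub>} \<union>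
        (\<lambda>z. x \<otimes>\<^bsub>H\<^esub> z) ` {z \<in> carrier H. g z \<noteq> \<one>\<^bsub>G\<^esub>}"
      by (cases "f z = \<one>\<^bsub>G\<^esub>") (auto intro!: rev_image_eqI)
  qed
  then have "finite {z \<in> carrier H. f z \<otimes>\<^bsub>G\<^esub> g (inv\<^bsub>H\<^esub> x \<otimes>\<^bsub>H\<^esub> z) \<noteq> \<one>\<^bsub>G\<^esub>}"
    using fin by (auto intro: finite_subset)
  moreover have "{z \<in> carrier H. (\<lambda>z\<in>carrier H. f z \<otimes>\<^bsub>G\<^esub> g (inv\<^bsub>H\<^esub> x \<otimes>\<^bsub>H\<^esub> z)) z \<noteq> \<one>\<^bsub>G\<^esub>} =
      {z \<in> carrier H. f z \<otimes>\<^bsub>G\<^esub> g (inv\<^bsub>H\<^esub> x \<otimes>\<^bsub>H\<^esub> z) \<noteq> \<one>\<^bsub>G\<^esub>}" by auto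
  ultimately show ?thesis
    using x y assms by (auto simp: wreath_mult wreath_carrier PiE_iff)
qed

lemma wreath_group: "group W"
proof (rule groupI)
  fix u v assume "u \<in> carrier W" "v \<in> carrier W"
  then show "u \<otimes>\<^bsub>W\<^esub> v \<in> carrier W" using wreath_mult_closed by (cases u, cases v) auto
next
  show "\<one>\<^bsub>W\<^esub> \<in> carrier W" by (simp add: wreath_one wreath_carrier)
next
  fix u v w assume *: "u \<in> carrier W" "v \<in> carrier W" "w \<in> carrier W"
  obtain f x g y h k where uvw: "u = (f, x)" "v = (g, y)" "w = (h, k)"
    by (metis prod.exhaust)
  then have "x \<in> carrier H" "y \<in> carrier H" "k \<in> carrier H"
    and "\<And>z. z \<in> carrier H \<Longrightarrow> f z \<in> carrier G" "\<And>z. z \<in> carrier H \<Longrightarrow> g z \<in> carrier G"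
      "\<And>z. z \<in> carrier H \<Longrightarrow> h z \<in> carrier G"
    using * by (auto simp: wreath_carrier)
  then show "u \<otimes>\<^bsub>W\<^esub> v \<otimes>\<^bsub>W\<^esub> w = u \<otimes>\<^bsub>W\<^esub> (v \<otimes>\<^bsub>W\<^esub> w)"
    by (auto simp: uvw wreath_mult G.m_assoc H.m_assoc H.inv_mult_group intro!: restrict_ext)
next
  fix u assume *: "u \<in> carrier W"
  obtain f x where u: "u = (f, x)" by (cases u)
  have "(\<lambda>z\<in>carrier H. \<one>\<^bsub>G\<^esub> \<otimes>\<^bsub>G\<^esub> f z) = f"
    using * by (auto simp: u wreath_carrier PiE_iff extensional_def)
  moreover have "(\<lambda>z\<in>carrier H. (\<lambda>z\<in>carrier H. \<one>\<^bsub>G\<^esub>) z \<otimes>\<^bsub>G\<^esub> f (inv\<^bsub>H\<^esub> \<one>\<^bsub>H\<^esub> \<otimes>\<^bsub>H\<^esub> z)) =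
      (\<lambda>z\<in>carrier H. \<one>\<^bsub>G\<^esub> \<otimes>\<^bsub>G\<^esub> f z)"
    by (rule restrict_ext) simp
  ultimately show "\<one>\<^bsub>W\<^esub> \<otimes>\<^bsub>W\<^esub> u = u"
    using * by (simp add: u wreath_mult wreath_one wreath_carrier)
next
  fix u assume *: "u \<in> carrier W"
  obtain f x where u: "u = (f, x)" by (cases u)
  have x: "x \<in> carrier H" and fin: "finite {z \<in> carrier H. f z \<noteq> \<one>\<^bsub>G\<^esub>}"
    and val: "\<And>z. z \<in> carrier H \<Longrightarrow> f z \<in> carrier G"
    using * by (auto simp: u wreath_carrier)
  define f' where "f' = (\<lambda>z\<in>carrier H. inv\<^bsub>G\<^esub> f (x \<otimes>\<^bsub>H\<^esub> z))"
  have "{z \<in> carrier H. f' z \<noteq> \<one>\<^bsub>G\<^esub>} \<subseteq>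
      (\<lambda>z. inv\<^bsub>H\<^esub> x \<otimes>\<^bsub>H\<^esub> z) ` {z \<in> carrier H. f z \<noteq> \<one>\<^bsub>G\<^esub>}"
  proof
    fix z assume z: "z \<in> {z \<in> carrier H. f' z \<noteq> \<one>\<^bsub>G\<^esub>}"
    then have "f (x \<otimes>\<^bsub>H\<^esub> z) \<noteq> \<one>\<^bsub>G\<^esub>" by (auto simp: f'_def)
    moreover have "z = inv\<^bsub>H\<^esub> x \<otimes>\<^bsub>H\<^esub> (x \<otimes>\<^bsub>H\<^esub> z)"
      using z x by (auto simp: H.m_assoc[symmetric])
    ultimately show "z \<in> (\<lambda>z. inv\<^bsub>H\<^esub> x \<otimes>\<^bsub>H\<^esub> z) ` {z \<in> carrier H. f z \<noteq> \<one>\<^bsub>G\<^esub>}"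
      using z x by (intro rev_image_eqI[of "x \<otimes>\<^bsub>H\<^esub> z"]) auto
  qed
  then have "finite {z \<in> carrier H. f' z \<noteq> \<one>\<^bsub>G\<^esub>}"
    using fin by (auto intro: finite_subset)
  then have "(f', inv\<^bsub>H\<^esub> x) \<in> carrier W"
    using x val by (auto simp: wreath_carrier f'_def)
  moreover have "(f', inv\<^bsub>H\<^esub> x) \<otimes>\<^bsub>W\<^esub> u = \<one>\<^bsub>W\<^esub>"
    using x val by (auto simp: u f'_def wreath_mult wreath_one intro!: restrict_ext)
  ultimately show "\<exists>v\<in>carrier W. v \<otimes>\<^bsub>W\<^esub> u = \<one>\<^bsub>W\<^esub>" by blast
qed

sublocale W: group "wreath G H" by (rule wreath_group)

lemma wreath_delta_lamp: "(wreath_delta G H a, \<one>\<^bsub>H\<^esub>) = lamp G H \<one>\<^bsub>H\<^esub> a"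
  by (simp add: lamp_def wreath_delta_def)

lemma lamp_closed:
  assumes "a \<in> carrier G" shows "lamp G H z a \<in> carrier W"
proof -
  have "finite {w \<in> carrier H. (\<lambda>w\<in>carrier H. if w = z then a else \<one>\<^bsub>G\<^esub>) w \<noteq> \<one>\<^bsub>G\<^esub>}"
    by (rule finite_subset[of _ "{z}"]) auto
  then show ?thesis using assms by (auto simp: lamp_def wreath_carrier)
qed

lemma shift_closed: "x \<in> carrier H \<Longrightarrow> shift G H x \<in> carrier W"
  by (simp add: shift_def wreath_carrier)

text \<open>Multiplying by a lamp on the left acts on the lamps in place, since a lamp does not move
  the marker.\<close>

lemma lamp_mult:
  assumes "x \<in> carrier H"
  shows "lamp G H z a \<otimes>\<^bsub>W\<^esub> (f, x) =
    ((\<lambda>w\<in>carrier H. (if w = z then a else \<one>\<^bsub>G\<^esub>) \<otimes>\<^bsub>G\<^esub> f w), x)"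
  using assms by (auto simp: lamp_def wreath_mult intro!: restrict_ext)

lemma lamp_hom: "lamp G H z \<in> hom G W"
proof (rule homI)
  fix a b assume "a \<in> carrier G" "b \<in> carrier G"
  then show "lamp G H z (a \<otimes>\<^bsub>G\<^esub> b) = lamp G H z a \<otimes>\<^bsub>W\<^esub> lamp G H z b"
    by (auto simp: lamp_def wreath_mult intro!: restrict_ext)
qed (rule lamp_closed)

lemma shift_hom: "shift G H \<in> hom H W"
proof (rule homI)
  fix x y assume "x \<in> carrier H" "y \<in> carrier H"
  then show "shift G H (x \<otimes>\<^bsub>H\<^esub> y) = shift G H x \<otimes>\<^bsub>W\<^esub> shift G H y"
    by (auto simp: shift_def wreath_mult intro!: restrict_ext)
qed (rule shift_closed)

lemma lamp_inv: "a \<in> carrier G \<Longrightarrow> inv\<^bsub>W\<^esub> lamp G H z a = lamp G H z (inv\<^bsub>G\<^esub> a)"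
  using group_hom.hom_inv[of G W "lamp G H z" a] lamp_hom
  by (simp add: group_hom_def group_hom_axioms_def G.is_group W.is_group)

lemma shift_inv: "x \<in> carrier H \<Longrightarrow> inv\<^bsub>W\<^esub> shift G H x = shift G H (inv\<^bsub>H\<^esub> x)"
  using group_hom.hom_inv[of H W "shift G H" x] shift_hom
  by (simp add: group_hom_def group_hom_axioms_def H.is_group W.is_group)

text \<open>To light a lamp at \<open>z\<close>, walk to \<open>z\<close>, work on the lamp there, and walk back.\<close>

lemma lamp_conjugate:
  assumes "z \<in> carrier H" "a \<in> carrier G"
  shows "lamp G H z a = shift G H z \<otimes>\<^bsub>W\<^esub> lamp G H \<one>\<^bsub>H\<^esub> a \<otimes>\<^bsub>W\<^esub> shift G H (inv\<^bsub>H\<^esub> z)"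
proof -
  have "inv\<^bsub>H\<^esub> z \<otimes>\<^bsub>H\<^esub> w = \<one>\<^bsub>H\<^esub> \<longleftrightarrow> w = z" if "w \<in> carrier H" for w
    using H.inv_solve_left[of "\<one>\<^bsub>H\<^esub>" z w] that assms by auto
  then show ?thesis
    using assms by (auto simp: lamp_def shift_def wreath_mult intro!: restrict_ext)
qed

lemma zero_section_subgroup: "subgroup (carrier (zero_section G H)) W"
proof (rule W.subgroupI)
  show "carrier (zero_section G H) \<subseteq> carrier W" by (auto simp: zero_section_def)
  show "carrier (zero_section G H) \<noteq> {}"
    using W.one_closed by (auto simp: zero_section_def wreath_one)
next
  fix u assume "u \<in> carrier (zero_section G H)"
  then obtain f where u: "u = (f, \<one>\<^bsub>H\<^esub>)" "u \<in> carrier W" by (auto simp: zero_section_def)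
  obtain g y where v: "inv\<^bsub>W\<^esub> u = (g, y)" by (cases "inv\<^bsub>W\<^esub> u")
  have "(g, y) \<in> carrier W" using u v W.inv_closed by metis
  moreover have "(g, y) \<otimes>\<^bsub>W\<^esub> (f, \<one>\<^bsub>H\<^esub>) = \<one>\<^bsub>W\<^esub>" using W.l_inv u v by metis
  ultimately have "(g, y) \<in> carrier W" "y = \<one>\<^bsub>H\<^esub>"
    by (auto simp: wreath_mult wreath_one wreath_carrier)
  then show "inv\<^bsub>W\<^esub> u \<in> carrier (zero_section G H)" by (auto simp: v zero_section_def)
next
  fix u v assume "u \<in> carrier (zero_section G H)" "v \<in> carrier (zero_section G H)"
  then obtain f g where u: "u = (f, \<one>\<^bsub>H\<^esub>)" "u \<in> carrier W" and v: "v = (g, \<one>\<^bsub>H\<^esub>)" "v \<in> carrier W"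
    by (auto simp: zero_section_def)
  then have "u \<otimes>\<^bsub>W\<^esub> v \<in> carrier W" by simp
  then show "u \<otimes>\<^bsub>W\<^esub> v \<in> carrier (zero_section G H)"
    using u v by (simp add: zero_section_def wreath_mult)
qed

lemma lamp_in_zero_section: "a \<in> carrier G \<Longrightarrow> lamp G H z a \<in> carrier (zero_section G H)"
  using lamp_closed[of a z] by (simp add: zero_section_def lamp_def)

end

locale generated_wreath_product = wreath_product G H
  for G :: "('g, 'm) monoid_scheme" and H :: "('h, 'n) monoid_scheme" +
  fixes SG :: "'g set" and SH :: "'h set"
  assumes SG: "symmetric_generating_set G SG" and SH: "symmetric_generating_set H SH"
begin

abbreviation T :: "(('h \<Rightarrow> 'g) \<times> 'h) set" where "T \<equiv> wreath_gens G H SG SH"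

lemma wreath_gens_eq: "T = shift G H ` SH \<union> lamp G H \<one>\<^bsub>H\<^esub> ` SG"
  by (simp add: wreath_gens_def shift_def wreath_delta_lamp)

lemma SG_carrier: "SG \<subseteq> carrier G" and SH_carrier: "SH \<subseteq> carrier H"
  and SG_generates: "generate G SG = carrier G" and SH_generates: "generate H SH = carrier H"
  and SG_inv: "s \<in> SG \<Longrightarrow> inv\<^bsub>G\<^esub> s \<in> SG" and SH_inv: "x \<in> SH \<Longrightarrow> inv\<^bsub>H\<^esub> x \<in> SH"
  using SG SH by (auto simp: symmetric_generating_set_def)

sublocale GL: symmetric_letters G SG
  by unfold_locales (use SG_carrier SG_inv in auto)

sublocale HL: symmetric_letters H SH
  by unfold_locales (use SH_carrier SH_inv in auto)

sublocale WL: symmetric_letters "wreath G H" T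
proof unfold_locales
  show "T \<subseteq> carrier W"
    using SG_carrier SH_carrier lamp_closed shift_closed by (auto simp: wreath_gens_eq)
  show "inv\<^bsub>W\<^esub> u \<in> T" if "u \<in> T" for u
    using that SG_carrier SH_carrier SG_inv SH_inv
    by (auto simp: wreath_gens_eq lamp_inv shift_inv subset_iff)
qed

lemma lamp_generated_and_short:
  assumes z: "z \<in> carrier H" and a: "a \<in> carrier G"
  shows "lamp G H z a \<in> generate W T"
    and "WL.len (lamp G H z a) \<le> 2 * HL.len z + GL.len a"
proof -
  have lamp1: "lamp G H \<one>\<^bsub>H\<^esub> a \<in> generate W T" "WL.len (lamp G H \<one>\<^bsub>H\<^esub> a) \<le> GL.len a"
    using a SG_generates wreath_gens_eq
      symmetric_letters_hom_generate[OF GL.symmetric_letters_axioms W.is_group lamp_hom]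
      word_length_hom_le[OF GL.symmetric_letters_axioms WL.symmetric_letters_axioms lamp_hom]
    by auto
  have shift: "shift G H x \<in> generate W T" "WL.len (shift G H x) \<le> HL.len x"
    if "x \<in> carrier H" for x
    using that SH_generates wreath_gens_eq
      symmetric_letters_hom_generate[OF HL.symmetric_letters_axioms W.is_group shift_hom]
      word_length_hom_le[OF HL.symmetric_letters_axioms WL.symmetric_letters_axioms shift_hom]
    by auto
  have z': "inv\<^bsub>H\<^esub> z \<in> carrier H" "HL.len (inv\<^bsub>H\<^esub> z) = HL.len z"
    using z HL.len_inv SH_generates by auto
  show "lamp G H z a \<in> generate W T"
    unfolding lamp_conjugate[OF z a] by (intro generate.eng lamp1 shift z z')
  have "WL.len (lamp G H z a) \<le>
      WL.len (shift G H z) + WL.len (lamp G H \<one>\<^bsub>H\<^esub> a) + WL.len (shift G H (inv\<^bsub>H\<^esub> z))"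
    unfolding lamp_conjugate[OF z a]
    by (meson WL.len_mult_le add_le_mono1 generate.eng lamp1(1) order_trans shift(1) z z'(1))
  also have "\<dots> \<le> HL.len z + GL.len a + HL.len z"
    using lamp1(2) shift(2)[OF z] shift(2)[OF z'(1)] z'(2) by linarith
  finally show "WL.len (lamp G H z a) \<le> 2 * HL.len z + GL.len a" by simp
qed

definition lamp_mass :: "'h set \<Rightarrow> ('h \<Rightarrow> 'g) \<times> 'h \<Rightarrow> nat" where
  "lamp_mass A u = (\<Sum>z\<in>A. GL.len (fst u z))"

text \<open>A letter appended to a word either moves the marker and leaves all lamps alone, or it changes
  the one lamp at the marker by a single generator of \<open>G\<close>. So the lamp mass grows by at most one
  per letter.\<close>

lemma lamp_mass_le_length:
  assumes "u \<in> generate W T" "finite A" "A \<subseteq> carrier H"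
  shows "lamp_mass A u \<le> WL.len u"
proof -
  have "lamp_mass A (word_prod W us) \<le> length us" if "set us \<subseteq> T" for us
    using that
  proof (induction us rule: rev_induct)
    case Nil
    have "lamp_mass A \<one>\<^bsub>W\<^esub> = 0"
      using assms(3) by (auto simp: lamp_mass_def wreath_one GL.len_one subset_iff)
    then show ?case by simp
  next
    case (snoc u us)
    obtain f x where fx: "word_prod W us = (f, x)" by (cases "word_prod W us")
    have c: "(f, x) \<in> carrier W"
      using W.word_prod_closed[of us] snoc.prems WL.S_carrier fx by auto
    then have x: "x \<in> carrier H" by (simp add: wreath_carrier)
    have u: "u \<in> T" "u \<in> carrier W" using snoc.prems WL.S_carrier by auto
    have "word_prod W (us @ [u]) = (f, x) \<otimes>\<^bsub>W\<^esub> u"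
      using snoc.prems WL.S_carrier u fx by (subst W.word_prod_append) auto
    moreover have "lamp_mass A ((f, x) \<otimes>\<^bsub>W\<^esub> u) \<le> lamp_mass A (f, x) + 1"
      using u(1) unfolding wreath_gens_eq
    proof
      assume "u \<in> shift G H ` SH"
      then have "fst ((f, x) \<otimes>\<^bsub>W\<^esub> u) z = f z" if "z \<in> A" for z
        using that x assms(3) wreath_value[OF c] by (auto simp: shift_def wreath_mult subset_iff)
      then show ?thesis by (simp add: lamp_mass_def)
    next
      assume "u \<in> lamp G H \<one>\<^bsub>H\<^esub> ` SG"
      then obtain s where s: "s \<in> SG" "u = lamp G H \<one>\<^bsub>H\<^esub> s" by blast
      have at: "inv\<^bsub>H\<^esub> x \<otimes>\<^bsub>H\<^esub> z = \<one>\<^bsub>H\<^esub> \<longleftrightarrow> z = x" if "z \<in> carrier H" for z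
        using H.inv_solve_left[of "\<one>\<^bsub>H\<^esub>" x z] that x by auto
      have "GL.len (fst ((f, x) \<otimes>\<^bsub>W\<^esub> u) z) \<le> GL.len (f z) + (if z = x then 1 else 0)"
        if "z \<in> A" for z
      proof -
        have z: "z \<in> carrier H" using that assms(3) by auto
        have "fst ((f, x) \<otimes>\<^bsub>W\<^esub> u) z = f z \<otimes>\<^bsub>G\<^esub> (if z = x then s else \<one>\<^bsub>G\<^esub>)"
          using z x at by (simp add: s(2) lamp_def wreath_mult)
        moreover have "GL.len (f z \<otimes>\<^bsub>G\<^esub> s) \<le> GL.len (f z) + 1"
          using GL.len_mult_le[of "f z" s] GL.len_letter_le[OF s(1)] SG_generates
            wreath_value[OF c z] s(1) SG_carrier by fastforce
        ultimately show ?thesis using wreath_value[OF c z] by auto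
      qed
      then have "lamp_mass A ((f, x) \<otimes>\<^bsub>W\<^esub> u) \<le> (\<Sum>z\<in>A. GL.len (f z) + (if z = x then 1 else 0))"
        unfolding lamp_mass_def by (rule sum_mono)
      also have "\<dots> \<le> lamp_mass A (f, x) + 1"
        using assms(2) by (simp add: lamp_mass_def sum.distrib)
      finally show ?thesis .
    qed
    ultimately show ?case using snoc fx by simp
  qed
  then show ?thesis using WL.geodesic_word[OF assms(1)] by metis
qed

text \<open>The triangle inequality at the site \<open>z\<close>; the other lamps are untouched.\<close>

lemma lamp_mass_lamp_mult:
  assumes "(f, x) \<in> carrier W" "finite A" "A \<subseteq> carrier H" "z \<in> A" "a \<in> carrier G"
  shows "lamp_mass A (f, x) + GL.len a \<le>
    lamp_mass A (lamp G H z a \<otimes>\<^bsub>W\<^esub> (f, x)) + 2 * GL.len (f z)"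
proof -
  have z: "z \<in> carrier H" using assms by auto
  have val: "f w \<in> carrier G" if "w \<in> carrier H" for w using wreath_value[OF assms(1) that] .
  have x: "x \<in> carrier H" using assms(1) by (simp add: wreath_carrier)
  have split: "lamp_mass A v = GL.len (fst v z) + (\<Sum>w\<in>A - {z}. GL.len (fst v w))" for v
    unfolding lamp_mass_def using assms by (simp add: sum.remove)
  have "(\<Sum>w\<in>A - {z}. GL.len (fst (lamp G H z a \<otimes>\<^bsub>W\<^esub> (f, x)) w)) = (\<Sum>w\<in>A - {z}. GL.len (f w))"
    using x assms(3) val by (intro sum.cong) (auto simp: lamp_mult subset_iff)
  moreover have "fst (lamp G H z a \<otimes>\<^bsub>W\<^esub> (f, x)) z = a \<otimes>\<^bsub>G\<^esub> f z"
    using x z by (simp add: lamp_mult)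
  moreover have "GL.len a \<le> GL.len (a \<otimes>\<^bsub>G\<^esub> f z) + GL.len (f z)"
    using GL.len_le_len_mult SG_generates val[OF z] assms(5) by simp
  ultimately show ?thesis using split[of "(f, x)"] split[of "lamp G H z a \<otimes>\<^bsub>W\<^esub> (f, x)"] by simp
qed

end

section \<open>Random walks with finitely supported steps\<close>

text \<open>The recursion peels off the first factor \<open>g\<^sub>1\<close>, but draws it last: conditionally on the
  product of the other factors it still has law \<open>\<mu>\<close>.\<close>

lemma walk_pmf_Suc:
  "walk_pmf K \<mu> (Suc k) = walk_pmf K \<mu> k \<bind> (\<lambda>w. map_pmf (\<lambda>x. x \<otimes>\<^bsub>K\<^esub> w) \<mu>)"
proof -
  have "walk_pmf K \<mu> (Suc k) =
      \<mu> \<bind> (\<lambda>x. replicate_pmf k \<mu> \<bind> (\<lambda>xs. return_pmf (x \<otimes>\<^bsub>K\<^esub> word_prod K xs)))"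
    by (simp add: walk_pmf_def map_bind_pmf)
  also have "\<dots> = replicate_pmf k \<mu> \<bind> (\<lambda>xs. \<mu> \<bind> (\<lambda>x. return_pmf (x \<otimes>\<^bsub>K\<^esub> word_prod K xs)))"
    by (rule bind_commute_pmf)
  also have "\<dots> = walk_pmf K \<mu> k \<bind> (\<lambda>w. map_pmf (\<lambda>x. x \<otimes>\<^bsub>K\<^esub> w) \<mu>)"
    by (simp add: walk_pmf_def map_pmf_def bind_assoc_pmf bind_return_pmf)
  finally show ?thesis .
qed

lemma walk_pmf_0: "walk_pmf K \<mu> 0 = return_pmf \<one>\<^bsub>K\<^esub>"
  by (simp add: walk_pmf_def)

lemma (in group) walk_pmf_1:
  assumes "set_pmf \<mu> \<subseteq> carrier G" shows "walk_pmf G \<mu> 1 = \<mu>"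
proof -
  have "walk_pmf G \<mu> 1 = map_pmf (\<lambda>x. x \<otimes> \<one>) \<mu>"
    using walk_pmf_Suc[of G \<mu> 0] by (simp add: walk_pmf_0 bind_return_pmf)
  also have "\<dots> = map_pmf (\<lambda>x. x) \<mu>"
    using assms by (intro map_pmf_cong) auto
  finally show ?thesis by simp
qed

lemma finite_set_walk_pmf: "finite (set_pmf \<mu>) \<Longrightarrow> finite (set_pmf (walk_pmf K \<mu> k))"
  by (induction k) (auto simp: walk_pmf_0 walk_pmf_Suc)

lemma set_walk_pmf_subset:
  assumes "subgroup N K" "set_pmf \<mu> \<subseteq> N"
  shows "set_pmf (walk_pmf K \<mu> k) \<subseteq> N"
proof (induction k)
  case 0
  then show ?case using subgroup.one_closed[OF assms(1)] by (simp add: walk_pmf_0)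
next
  case (Suc k)
  then show ?case
    using assms(2) subgroup.m_closed[OF assms(1)] by (auto simp: walk_pmf_Suc subset_iff)
qed

lemma (in group) symmetric_pmf_onI:
  assumes "set_pmf \<mu> \<subseteq> carrier G" "map_pmf (m_inv G) \<mu> = \<mu>"
  shows "symmetric_pmf_on G \<mu>"
proof -
  have inj: "inj_on (m_inv G) (carrier G)" by (rule inv_inj)
  have supp: "inv g \<in> set_pmf \<mu>" if "g \<in> set_pmf \<mu>" for g
    using that assms(2) set_map_pmf[of "m_inv G" \<mu>] by auto
  have "pmf \<mu> g = pmf \<mu> (inv g)" if g: "g \<in> carrier G" for g
  proof (cases "g \<in> set_pmf \<mu>")
    case True
    then show ?thesis
      using pmf_map_inj[of "m_inv G" \<mu> g] inj_on_subset[OF inj assms(1)] assms(2) by simp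
  next
    case False
    then have "inv g \<notin> set_pmf \<mu>" using supp[of "inv g"] g by auto
    with False show ?thesis by (simp add: set_pmf_iff)
  qed
  then show ?thesis unfolding symmetric_pmf_on_def using assms(1) by blast
qed

section \<open>The random walk that switches far-away lamps\<close>

text \<open>A uniform site and an independent fair sign. Taking the image of the uniform law on pairs keeps
  the symmetry visible (it is the flip of the sign) also when \<open>a\<close> is an involution and the two
  signs give the same group element.\<close>

definition lamp_pmf ::
  "('g, 'm) monoid_scheme \<Rightarrow> ('h, 'n) monoid_scheme \<Rightarrow> 'h set \<Rightarrow> 'g \<Rightarrow> (('h \<Rightarrow> 'g) \<times> 'h) pmf" where
  "lamp_pmf G H A a =
     map_pmf (\<lambda>(z, b). lamp G H z (if b then a else inv\<^bsub>G\<^esub> a)) (pmf_of_set (A \<times> UNIV))"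

context generated_wreath_product
begin

context
  fixes A :: "'h set" and a :: 'g
  assumes A: "finite A" "A \<noteq> {}" "A \<subseteq> carrier H" and a: "a \<in> carrier G"
begin

lemma set_lamp_pmf: "set_pmf (lamp_pmf G H A a) = (\<Union>z\<in>A. {lamp G H z a, lamp G H z (inv\<^bsub>G\<^esub> a)})"
  using A by (simp add: lamp_pmf_def Sigma_def image_UN UNIV_bool insert_commute)

lemma finite_set_lamp_pmf: "finite (set_pmf (lamp_pmf G H A a))"
  using A by (simp add: set_lamp_pmf)

lemma lamp_pmf_in_zero_section: "set_pmf (lamp_pmf G H A a) \<subseteq> carrier (zero_section G H)"
  using a lamp_in_zero_section by (auto simp: set_lamp_pmf)

lemma lamp_pmf_generated: "set_pmf (lamp_pmf G H A a) \<subseteq> generate W T"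
  using a A lamp_generated_and_short(1) by (auto simp: set_lamp_pmf)

lemma lamp_pmf_walk_generated: "set_pmf (walk_pmf W (lamp_pmf G H A a) k) \<subseteq> generate W T"
  using set_walk_pmf_subset[OF W.generate_is_subgroup lamp_pmf_generated] WL.S_carrier by blast

lemma lamp_pmf_symmetric: "symmetric_pmf_on (zero_section G H) (lamp_pmf G H A a)"
proof (rule group.symmetric_pmf_onI)
  show "group (zero_section G H)"
    using W.subgroup_imp_group[OF zero_section_subgroup] by (simp add: zero_section_def)
  show "set_pmf (lamp_pmf G H A a) \<subseteq> carrier (zero_section G H)"
    by (rule lamp_pmf_in_zero_section)
  have "inv\<^bsub>zero_section G H\<^esub> u = inv\<^bsub>W\<^esub> u" if "u \<in> carrier (zero_section G H)" for u
    using W.m_inv_consistent[OF zero_section_subgroup that] by (simp add: zero_section_def)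
  then have "map_pmf (m_inv (zero_section G H)) (lamp_pmf G H A a) =
      map_pmf (m_inv W) (lamp_pmf G H A a)"
    using lamp_pmf_in_zero_section by (intro map_pmf_cong) auto
  also have "\<dots> = map_pmf (\<lambda>(z, b). lamp G H z (if b then a else inv\<^bsub>G\<^esub> a))
      (map_pmf (map_prod id Not) (pmf_of_set (A \<times> UNIV)))"
    unfolding lamp_pmf_def map_pmf_comp using a by (intro map_pmf_cong) (auto simp: lamp_inv)
  also have "map_pmf (map_prod id Not) (pmf_of_set (A \<times> UNIV)) = pmf_of_set (A \<times> UNIV)"
  proof -
    have "bij_betw (map_prod id Not) (A \<times> UNIV) (A \<times> UNIV)"
      by (rule bij_betw_byWitness[of _ "map_prod id Not"]) auto
    then show ?thesis using A by (intro map_pmf_of_set_bij_betw) auto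
  qed
  finally show "map_pmf (m_inv (zero_section G H)) (lamp_pmf G H A a) = lamp_pmf G H A a"
    by (simp add: lamp_pmf_def)
qed

lemma lamp_pmf_length:
  assumes "u \<in> set_pmf (lamp_pmf G H A a)" "\<And>z. z \<in> A \<Longrightarrow> HL.len z \<le> r"
  shows "GL.len a \<le> WL.len u" "WL.len u \<le> 2 * r + GL.len a"
proof -
  obtain z b where u: "z \<in> A" "u = lamp G H z b" "b = a \<or> b = inv\<^bsub>G\<^esub> a"
    using assms(1) by (auto simp: set_lamp_pmf)
  then have z: "z \<in> carrier H" and b: "b \<in> carrier G" "GL.len b = GL.len a"
    using A a GL.len_inv SG_generates by auto
  have "lamp_mass {z} u = GL.len a" using z b u by (simp add: lamp_mass_def lamp_def)
  then show "GL.len a \<le> WL.len u"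
    using lamp_mass_le_length[of u "{z}"] lamp_generated_and_short(1)[OF z b(1)] z u(2) by simp
  show "WL.len u \<le> 2 * r + GL.len a"
    using lamp_generated_and_short(2)[OF z b(1)] assms(2)[OF u(1)] unfolding u(2) b(2) by linarith
qed

text \<open>Averaging the triangle inequality at the switched site over all sites of \<open>A\<close>: on average a
  step adds the full length of \<open>a\<close>, minus at most twice the mean length of a lamp on \<open>A\<close>.\<close>

lemma expected_lamp_mass_step:
  assumes "w \<in> carrier W"
  shows "(1 - 2 / card A) * lamp_mass A w + GL.len a \<le>
    measure_pmf.expectation (lamp_pmf G H A a) (\<lambda>u. real (lamp_mass A (u \<otimes>\<^bsub>W\<^esub> w)))"
proof -
  obtain f x where w: "w = (f, x)" by (cases w)
  let ?b = "\<lambda>c. if c then a else inv\<^bsub>G\<^esub> a"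
  have n: "real (card A) > 0" using A by (simp add: card_gt_0_iff)
  have b: "?b c \<in> carrier G" "GL.len (?b c) = GL.len a" for c
    using a GL.len_inv SG_generates by auto
  have site: "real (lamp_mass A w) + GL.len a - 2 * real (GL.len (f z)) \<le>
      real (lamp_mass A (lamp G H z (?b c) \<otimes>\<^bsub>W\<^esub> w))" if "z \<in> A" for z c
  proof -
    have "lamp_mass A w + GL.len (?b c) \<le>
        lamp_mass A (lamp G H z (?b c) \<otimes>\<^bsub>W\<^esub> w) + 2 * GL.len (f z)"
      unfolding w using lamp_mass_lamp_mult A that b(1) assms w by blast
    then show ?thesis unfolding b(2) by linarith
  qed
  have both: "(\<Sum>(z, c)\<in>A \<times> (UNIV :: bool set). h z) = 2 * (\<Sum>z\<in>A. h z)" for h :: "'h \<Rightarrow> real"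
    by (simp add: sum.cartesian_product[symmetric] sum_distrib_left)
  have "(\<Sum>z\<in>A. real (lamp_mass A w) + GL.len a - 2 * real (GL.len (f z))) =
      card A * (real (lamp_mass A w) + GL.len a) - 2 * real (lamp_mass A w)"
    unfolding sum_subtractf by (simp add: sum_distrib_left lamp_mass_def w)
  then have "2 * card A * (real (lamp_mass A w) + GL.len a) - 4 * real (lamp_mass A w) =
      (\<Sum>(z, c)\<in>A \<times> (UNIV :: bool set). real (lamp_mass A w) + GL.len a - 2 * real (GL.len (f z)))"
    unfolding both by simp
  also have "\<dots> \<le> (\<Sum>(z, c)\<in>A \<times> UNIV. real (lamp_mass A (lamp G H z (?b c) \<otimes>\<^bsub>W\<^esub> w)))"
    using site by (intro sum_mono) auto
  also have "\<dots> = 2 * card A *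
      measure_pmf.expectation (lamp_pmf G H A a) (\<lambda>u. real (lamp_mass A (u \<otimes>\<^bsub>W\<^esub> w)))"
    using A n by (simp add: lamp_pmf_def integral_pmf_of_set card_cartesian_product case_prod_beta)
  finally show ?thesis using n by (simp add: field_simps)
qed

text \<open>For \<open>n = card A \<ge> 2\<close> the one-step bound \<open>(1 - 2 / n) m + l\<close> is monotone in the mass \<open>m\<close>
  that is already present, so a lower bound \<open>k l / 3\<close> on the expectation propagates: the loss
  \<open>(2 / n) (k l / 3)\<close> is at most \<open>2 l / 3\<close> for \<open>k \<le> n\<close>, which leaves a gain of \<open>l / 3\<close>.\<close>

lemma expected_lamp_mass_walk:
  assumes "2 \<le> card A" "k \<le> card A"
  shows "real k * GL.len a / 3 \<le>
    measure_pmf.expectation (walk_pmf W (lamp_pmf G H A a) k) (\<lambda>w. real (lamp_mass A w))"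
  using assms(2)
proof (induction k)
  case 0
  then show ?case by simp
next
  case (Suc k)
  let ?\<mu> = "lamp_pmf G H A a" and ?n = "real (card A)" and ?l = "real (GL.len a)"
  let ?\<nu> = "walk_pmf W ?\<mu> k"
  let ?E = "measure_pmf.expectation ?\<nu> (\<lambda>w. real (lamp_mass A w))"
  have fin: "finite (set_pmf ?\<nu>)" by (intro finite_set_walk_pmf finite_set_lamp_pmf)
  have "(1 - 2 / ?n) * ?E + ?l =
      measure_pmf.expectation ?\<nu> (\<lambda>w. (1 - 2 / ?n) * real (lamp_mass A w) + ?l)"
    by (subst Bochner_Integration.integral_add) (auto intro: integrable_measure_pmf_finite[OF fin])
  also have "\<dots> = (\<Sum>w\<in>set_pmf ?\<nu>. pmf ?\<nu> w * ((1 - 2 / ?n) * lamp_mass A w + ?l))"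
    by (subst integral_measure_pmf[OF fin]) auto
  also have "\<dots> \<le> (\<Sum>w\<in>set_pmf ?\<nu>. pmf ?\<nu> w *
      measure_pmf.expectation ?\<mu> (\<lambda>u. real (lamp_mass A (u \<otimes>\<^bsub>W\<^esub> w))))"
    using lamp_pmf_walk_generated[THEN subsetD, THEN WL.generate_closed]
    by (intro sum_mono mult_left_mono expected_lamp_mass_step) simp_all
  also have "\<dots> = measure_pmf.expectation (walk_pmf W ?\<mu> (Suc k)) (\<lambda>w. real (lamp_mass A w))"
    unfolding walk_pmf_Suc using fin finite_set_lamp_pmf
    by (subst pmf_expectation_bind[of "set_pmf ?\<nu>"]) auto
  finally have step: "(1 - 2 / ?n) * ?E + ?l \<le>
      measure_pmf.expectation (walk_pmf W ?\<mu> (Suc k)) (\<lambda>w. real (lamp_mass A w))" .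
  have "real k / ?n \<le> 1" using Suc.prems by (simp add: divide_le_eq)
  then have "?l * (real k / ?n) \<le> ?l" using mult_left_mono[of "real k / ?n" 1 ?l] by simp
  moreover have "(1 - 2 / ?n) * (real k * ?l / 3) = real k * ?l / 3 - 2 / 3 * (?l * (real k / ?n))"
    by (simp add: algebra_simps diff_divide_distrib)
  moreover have "real (Suc k) * ?l / 3 = real k * ?l / 3 + ?l / 3"
    by (simp add: distrib_right add_divide_distrib)
  ultimately have "real (Suc k) * ?l / 3 \<le> (1 - 2 / ?n) * (real k * ?l / 3) + ?l"
    by linarith
  also have "\<dots> \<le> (1 - 2 / ?n) * ?E + ?l"
    using Suc assms(1) by (intro add_right_mono mult_left_mono) (auto simp: divide_le_eq)
  finally show ?case using step by linarith
qed

end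

lemma walk_pmf_zero_section: "walk_pmf (zero_section G H) \<mu> k = walk_pmf W \<mu> k"
  by (simp add: walk_pmf_def word_prod_def[abs_def] zero_section_def)

lemma wreath_dist_one:
  assumes "u \<in> generate W T"
  shows "wreath_dist G H SG SH u \<one>\<^bsub>zero_section G H\<^esub> = WL.len u"
  using assms WL.len_inv WL.generate_inv WL.generate_closed
  by (simp add: wreath_dist_def word_dist_def zero_section_def)

lemma moment_bounds:
  assumes "set_pmf \<nu> \<subseteq> generate W T" "0 \<le> p"
    and "\<And>u. u \<in> set_pmf \<nu> \<Longrightarrow> lo \<le> WL.len u \<and> WL.len u \<le> hi"
  shows "ennreal (real lo powr p) \<le> moment p (zero_section G H) (wreath_dist G H SG SH) \<nu>"
    and "moment p (zero_section G H) (wreath_dist G H SG SH) \<nu> \<le> ennreal (real hi powr p)"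
proof -
  let ?\<rho> = "wreath_dist G H SG SH"
  have *: "ennreal (real lo powr p) \<le> ennreal (?\<rho> u \<one>\<^bsub>zero_section G H\<^esub> powr p)"
    "ennreal (?\<rho> u \<one>\<^bsub>zero_section G H\<^esub> powr p) \<le> ennreal (real hi powr p)" if "u \<in> set_pmf \<nu>" for u
    using assms(2) assms(3)[OF that] wreath_dist_one[OF subsetD[OF assms(1) that]]
    by (auto intro!: ennreal_leI powr_mono2)
  have "(\<integral>\<^sup>+ u. ennreal (real lo powr p) \<partial>measure_pmf \<nu>) \<le> moment p (zero_section G H) ?\<rho> \<nu>"
    unfolding moment_def by (intro nn_integral_mono_AE) (use * in \<open>auto simp: AE_measure_pmf_iff\<close>)
  then show "ennreal (real lo powr p) \<le> moment p (zero_section G H) ?\<rho> \<nu>" by simp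
  have "moment p (zero_section G H) ?\<rho> \<nu> \<le> (\<integral>\<^sup>+ u. ennreal (real hi powr p) \<partial>measure_pmf \<nu>)"
    unfolding moment_def by (intro nn_integral_mono_AE) (use * in \<open>auto simp: AE_measure_pmf_iff\<close>)
  then show "moment p (zero_section G H) ?\<rho> \<nu> \<le> ennreal (real hi powr p)" by simp
qed

lemma moment_1_eq_expectation:
  assumes "set_pmf \<nu> \<subseteq> generate W T" "finite (set_pmf \<nu>)"
  shows "moment 1 (zero_section G H) (wreath_dist G H SG SH) \<nu> =
    ennreal (measure_pmf.expectation \<nu> (\<lambda>u. real (WL.len u)))"
proof -
  have "moment 1 (zero_section G H) (wreath_dist G H SG SH) \<nu> =
      (\<integral>\<^sup>+ u. ennreal (real (WL.len u)) \<partial>measure_pmf \<nu>)"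
    unfolding moment_def using assms(1)
    by (intro nn_integral_cong_AE) (auto simp: AE_measure_pmf_iff wreath_dist_one subset_iff)
  then show ?thesis
    using assms(2) by (simp add: nn_integral_eq_integral integrable_measure_pmf_finite)
qed

end

section \<open>The lower bound on the exponent\<close>

lemma elog_ennreal: "0 < x \<Longrightarrow> elog (ennreal x) = ereal (ln x)"
  by (simp add: elog_def)

lemma log_ratio_tendsto:
  fixes p :: real
  assumes "0 \<le> p"
  shows "(\<lambda>t. ln (real t * real t / 3) / ln (real t * (3 * real t) powr p)) \<longlonglongrightarrow> 2 / (p + 1)"
proof -
  let ?L = "\<lambda>t. ln (real t)"
  have L: "filterlim ?L at_top sequentially"
    by (rule filterlim_compose[OF ln_at_top filterlim_real_sequentially])
  have inv0: "(\<lambda>t. c / ?L t) \<longlonglongrightarrow> 0" for c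
    by (rule tendsto_divide_0[OF tendsto_const filterlim_at_top_imp_at_infinity[OF L]])
  have "(\<lambda>t. (2 - ln 3 / ?L t) / ((p + 1) + p * ln 3 / ?L t)) \<longlonglongrightarrow> (2 - 0) / ((p + 1) + 0)"
    by (intro tendsto_intros inv0) (use assms in auto)
  moreover have "\<forall>\<^sub>F t in sequentially. (2 - ln 3 / ?L t) / ((p + 1) + p * ln 3 / ?L t) =
      ln (real t * real t / 3) / ln (real t * (3 * real t) powr p)"
  proof (rule eventually_mono[OF eventually_ge_at_top[of 2]])
    fix t :: nat assume t: "2 \<le> t"
    then have Lt: "?L t > 0" by simp
    have "ln (real t * real t / 3) = ?L t * (2 - ln 3 / ?L t)"
      using t Lt by (simp add: ln_div ln_mult algebra_simps)
    moreover have "ln (real t * (3 * real t) powr p) = ?L t * ((p + 1) + p * ln 3 / ?L t)"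
      using t Lt by (simp add: ln_mult ln_powr algebra_simps)
    ultimately show "(2 - ln 3 / ?L t) / ((p + 1) + p * ln 3 / ?L t) =
        ln (real t * real t / 3) / ln (real t * (3 * real t) powr p)"
      using Lt by simp
  qed
  ultimately show ?thesis by (simp add: tendsto_cong)
qed

theorem theorem7p1:
  fixes G :: "('g, 'm) monoid_scheme" and H :: "('h, 'n) monoid_scheme"
    and SG :: "'g set" and SH :: "'h set" and p :: real
  assumes "group G" and "group H"
    and "infinite (carrier G)" and "infinite (carrier H)"
    and "finite SG" and "symmetric_generating_set G SG"
    and "finite SH" and "symmetric_generating_set H SH"
    and "p \<in> {1..2}"
  shows "beta_star p (zero_section G H) (wreath_dist G H SG SH) \<ge> ereal (2 / (p + 1))"
proof -
  interpret generated_wreath_product G H SG SH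
    by (intro generated_wreath_product.intro wreath_product.intro
        generated_wreath_product_axioms.intro assms)
  let ?Z = "zero_section G H" and ?\<rho> = "wreath_dist G H SG SH"
  have p: "0 \<le> p" "1 \<le> p" using assms by auto
  have "\<forall>t. \<exists>g. g \<in> carrier G \<and> GL.len g = t"
    using GL.element_of_length assms SG_generates by metis
  then obtain a where a: "\<And>t. a t \<in> carrier G" "\<And>t. GL.len (a t) = t"
    by metis
  have "\<forall>t. \<exists>z. z \<in> carrier H \<and> HL.len z = t"
    using HL.element_of_length assms SH_generates by metis
  then obtain s where s: "\<And>t. s t \<in> carrier H" "\<And>t. HL.len (s t) = t"
    by metis
  \<comment> \<open>\<open>t\<close> steps are spread over \<open>t\<close> sites at distance below \<open>t\<close>, with lamps of length \<open>t\<close>: reaching a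
    site then costs no more than setting its lamp, up to a constant factor.\<close>
  define A where "A t = s ` {..<t}" for t :: nat
  define \<mu> where "\<mu> t = lamp_pmf G H (A t) (a t)" for t
  have "inj s" by (metis s(2) injI)
  then have cardA: "card (A t) = t" for t
    by (simp add: A_def card_image inj_on_subset)
  have A: "finite (A t)" "A t \<noteq> {}" "A t \<subseteq> carrier H" if "1 \<le> t" for t
    using that s by (auto simp: A_def lessThan_empty_iff)
  have short: "HL.len z \<le> t" if "z \<in> A t" for z t
    using that s by (auto simp: A_def)
  have len: "t \<le> WL.len u \<and> WL.len u \<le> 3 * t" if "1 \<le> t" "u \<in> set_pmf (\<mu> t)" for t u
    using lamp_pmf_length[OF A[OF that(1)] a(1) that(2)[unfolded \<mu>_def] short[of _ t]] a(2)[of t] by simp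
  have step: "ennreal (real t powr p) \<le> moment p ?Z ?\<rho> (\<mu> t)"
    "moment p ?Z ?\<rho> (\<mu> t) \<le> ennreal ((3 * real t) powr p)" if "1 \<le> t" for t
    using moment_bounds[of "\<mu> t" p t "3 * t"] len[OF that] p
      lamp_pmf_generated[OF A[OF that] a(1)] by (auto simp: \<mu>_def)
  have "admissible p ?Z ?\<rho> \<mu>"
    unfolding admissible_def
  proof (intro conjI allI impI)
    fix t :: nat assume t: "1 \<le> t"
    show "symmetric_pmf_on ?Z (\<mu> t)"
      unfolding \<mu>_def by (rule lamp_pmf_symmetric[OF A[OF t] a(1)])
    show "moment p ?Z ?\<rho> (\<mu> t) < \<infinity>"
      using step(2)[OF t] by (rule le_less_trans) simp
  next
    have "real t * measure_pmf.prob (\<mu> t) (carrier ?Z - {\<one>\<^bsub>?Z\<^esub>}) = real t" if t: "1 \<le> t" for t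
    proof -
      have "\<one>\<^bsub>?Z\<^esub> \<notin> set_pmf (\<mu> t)"
        using len[OF t, of "\<one>\<^bsub>?Z\<^esub>"] t WL.len_one by (auto simp: zero_section_def)
      then have "set_pmf (\<mu> t) \<subseteq> carrier ?Z - {\<one>\<^bsub>?Z\<^esub>}"
        using lamp_pmf_in_zero_section[OF A[OF t] a(1)] by (auto simp: \<mu>_def)
      then have "measure_pmf.prob (\<mu> t) (carrier ?Z - {\<one>\<^bsub>?Z\<^esub>}) = 1"
        by (subst measure_pmf.prob_eq_1) (auto simp: AE_measure_pmf_iff)
      then show ?thesis by simp
    qed
    then have ev: "\<forall>\<^sub>F t in sequentially.
        real t = real t * measure_pmf.prob (\<mu> t) (carrier ?Z - {\<one>\<^bsub>?Z\<^esub>})"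
      by (intro eventually_mono[OF eventually_ge_at_top[of 1]]) simp
    show "LIM t sequentially.
        real t * measure_pmf.prob (\<mu> t) (carrier ?Z - {\<one>\<^bsub>?Z\<^esub>}) :> at_top"
      by (rule iffD1[OF filterlim_cong[OF refl refl ev] filterlim_real_sequentially])
  qed
  then have upper: "beta_star_seq p ?Z ?\<rho> \<mu> \<le> beta_star p ?Z ?\<rho>"
    unfolding beta_star_def by (intro SUP_upper) simp
  have "ereal (ln (real t * real t / 3) / ln (real t * (3 * real t) powr p)) \<le>
      elog (moment 1 ?Z ?\<rho> (walk_pmf ?Z (\<mu> t) t)) /
      elog (of_nat t * moment p ?Z ?\<rho> (walk_pmf ?Z (\<mu> t) 1))" if t: "2 \<le> t" for t
  proof -
    have t1: "1 \<le> t" using t by simp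
    let ?\<nu> = "walk_pmf W (\<mu> t) t"
    define m where "m = measure_pmf.expectation ?\<nu> (\<lambda>u. real (WL.len u))"
    have gen: "set_pmf ?\<nu> \<subseteq> generate W T"
      unfolding \<mu>_def by (rule lamp_pmf_walk_generated[OF A[OF t1] a(1)])
    have fin: "finite (set_pmf ?\<nu>)"
      unfolding \<mu>_def by (intro finite_set_walk_pmf finite_set_lamp_pmf[OF A[OF t1] a(1)])
    have "real t * real t / 3 \<le> measure_pmf.expectation ?\<nu> (\<lambda>u. real (lamp_mass (A t) u))"
      using expected_lamp_mass_walk[OF A[OF t1] a(1)[of t], of t] t
      by (simp add: \<mu>_def cardA a(2))
    also have "\<dots> \<le> m"
      unfolding m_def
      by (intro integral_mono_AE integrable_measure_pmf_finite fin)
        (use gen lamp_mass_le_length[OF _ A(1,3)[OF t1]] in \<open>auto simp: AE_measure_pmf_iff\<close>)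
    finally have m: "real t * real t / 3 \<le> m" .
    \<comment> \<open>From \<open>t = 2\<close> on the numerator \<open>ln (t\<^sup>2 / 3)\<close> of the comparison quotient is positive.\<close>
    have tt: "4 \<le> real t * real t"
      using mult_mono[of 2 "real t" 2 "real t"] t by simp
    have num: "elog (moment 1 ?Z ?\<rho> (walk_pmf ?Z (\<mu> t) t)) = ereal (ln m)"
      unfolding walk_pmf_zero_section moment_1_eq_expectation[OF gen fin] m_def[symmetric]
      using m tt by (intro elog_ennreal) linarith
    have "walk_pmf ?Z (\<mu> t) 1 = \<mu> t"
      unfolding walk_pmf_zero_section using lamp_pmf_generated[OF A[OF t1] a(1)] WL.generate_closed
      by (intro W.walk_pmf_1) (auto simp: \<mu>_def)
    moreover obtain q where q: "0 \<le> q" "moment p ?Z ?\<rho> (\<mu> t) = ennreal q"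
      using step(2)[OF t1] by (cases "moment p ?Z ?\<rho> (\<mu> t)") (auto simp: top_unique)
    ultimately have "of_nat t * moment p ?Z ?\<rho> (walk_pmf ?Z (\<mu> t) 1) = ennreal (real t * q)"
      by (simp add: ennreal_mult ennreal_of_nat_eq_real_of_nat)
    moreover have q_bounds: "real t powr p \<le> q" "q \<le> (3 * real t) powr p"
      using step[OF t1] q by (auto simp: ennreal_le_iff)
    moreover have "1 \<le> real t powr p"
      using t p by (intro ge_one_powr_ge_zero) auto
    then have d: "1 < real t * q"
      using q_bounds(1) t mult_mono[of 2 "real t" 1 q] by linarith
    ultimately have den: "elog (of_nat t * moment p ?Z ?\<rho> (walk_pmf ?Z (\<mu> t) 1)) = ereal (ln (real t * q))"
      by (simp add: elog_ennreal)
    have ln_pos: "0 < ln (real t * q)" using d by simp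
    have "ln (real t * real t / 3) / ln (real t * (3 * real t) powr p) \<le> ln m / ln (real t * q)"
    proof (rule frac_le)
      show "ln (real t * real t / 3) \<le> ln m" using m tt by (intro ln_mono) auto
      show "0 \<le> ln m" using m tt by (intro ln_ge_zero) linarith
      show "0 < ln (real t * q)" by (rule ln_pos)
      show "ln (real t * q) \<le> ln (real t * (3 * real t) powr p)"
        using d q_bounds(2) by (intro ln_mono mult_left_mono) auto
    qed
    then show ?thesis unfolding num den ereal_divide using ln_pos by auto
  qed
  then have "limsup (\<lambda>t. ereal (ln (real t * real t / 3) / ln (real t * (3 * real t) powr p))) \<le>
      beta_star_seq p ?Z ?\<rho> \<mu>"
    unfolding beta_star_seq_def
    by (intro Limsup_mono eventually_mono[OF eventually_ge_at_top[of 2]]) simp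
  moreover have "limsup (\<lambda>t. ereal (ln (real t * real t / 3) / ln (real t * (3 * real t) powr p))) =
      ereal (2 / (p + 1))"
    using log_ratio_tendsto[OF p(1)] by (intro lim_imp_Limsup) auto
  ultimately show ?thesis using upper by simp
qed

end
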